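(* Let $G$ be a group acting by automorphisms on an abelian group $K$. Then for any two derivations $d,d'\colon G\to K$ relative to this action, $\mathrm{tc}(d)=\mathrm{tc}(d')$.
   Context: All groups are discrete; $G$ is written multiplicatively and $K$ additively. If $G$ acts on $K$ by automorphisms, $(g,k)\mapsto g\cdot k$, the semi-direct product $K\rtimes G$ is the set $K\times G$ with $(k,g)(k',g')=(k+g\cdot k',gg')$, with projection $p\colon K\rtimes G\to G$, $p(k,g)=g$. A derivation is a function $d\colon G\to K$ with $d(gh)=d(g)+g\cdot d(h)$; it determines the splitting $s_d(g)=(d(g),g)$ of $p$. A functorial classifying space construction gives a fibration $Bp\colon B(K\rtimes G)\to BG$ with fibre $BK$ and section $B(s_d)$. For a fibration $q\colon E\to Y$, the sectional category $\mathrm{secat}(q)$ is the minimal $n$ such that $Y$ has an open cover $U_0,\dots,U_n$ with each $U_i$ admitting a section $U_i\to E$ of $q$ ($\infty$ if there is no such $n$). For a fibration $q\colon X\to B$ with section $s\colon B\to X$, let $P_BX=\{\alpha\colon I\to X \text{ continuous}\mid q\circ\alpha \text{ constant},\ \alpha(0)=s(q(\alpha(0)))\}$ and $\mathrm{ev}_1\colon P_BX\to X$, $\alpha\mapsto\alpha(1)$. The complexity of $d$ is the $BG$-parametrized LS-category of $B(K\rtimes G)$ with respect to the section $B(s_d)$ of $Bp$, that is, $$\mathrm{tc}(d):=\mathrm{cat}_{BG}(B(K\rtimes G))=\mathrm{secat}\big(\mathrm{ev}_1\colon P_{BG}B(K\rtimes G)\to B(K\rtimes G)\big).$$ *)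

theory Defs
  imports "HOL-Homology.Simplices" "HOL-Algebra.Bij" "HOL-Library.Extended_Nat"
begin

section \<open>Semi-direct products and derivations\<close>

text \<open>
  Both groups are written multiplicatively, as HOL-Algebra groups, so the addition of \<open>K\<close> is
  \<open>\<otimes>\<^bsub>K\<^esub>\<close>. An action of \<open>G\<close> on \<open>K\<close> by automorphisms is a homomorphism
  \<open>act \<in> hom G (AutoGroup K)\<close>. No definition below requires \<open>K\<close> to be commutative.
\<close>

definition semidirect ::
    "('k, 'b) monoid_scheme \<Rightarrow> ('g, 'c) monoid_scheme \<Rightarrow> ('g \<Rightarrow> 'k \<Rightarrow> 'k) \<Rightarrow> ('k \<times> 'g) monoid" where
  "semidirect K G act =
     \<lparr>carrier = carrier K \<times> carrier G,
      mult = (\<lambda>(k, g) (k', g'). (k \<otimes>\<^bsub>K\<^esub> act g k', g \<otimes>\<^bsub>G\<^esub> g')),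
      one = (\<one>\<^bsub>K\<^esub>, \<one>\<^bsub>G\<^esub>)\<rparr>"

definition derivation ::
    "('k, 'b) monoid_scheme \<Rightarrow> ('g, 'c) monoid_scheme \<Rightarrow> ('g \<Rightarrow> 'k \<Rightarrow> 'k) \<Rightarrow> ('g \<Rightarrow> 'k) \<Rightarrow> bool" where
  "derivation K G act d \<longleftrightarrow>
     d \<in> carrier G \<rightarrow> carrier K \<and>
     (\<forall>g\<in>carrier G. \<forall>h\<in>carrier G. d (g \<otimes>\<^bsub>G\<^esub> h) = d g \<otimes>\<^bsub>K\<^esub> act g (d h))"

definition splitting :: "('g \<Rightarrow> 'k) \<Rightarrow> 'g \<Rightarrow> 'k \<times> 'g" where
  "splitting d g = (d g, g)"


section \<open>The classifying space of a discrete group\<close>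

text \<open>
  The classifying space is the geometric realization of the nerve (the bar construction).
  An \<open>n\<close>-simplex of the nerve of \<open>G\<close> is a list \<open>[g\<^sub>1, \<dots>, g\<^sub>n]\<close> over the carrier. A monotone map
  \<open>\<theta> : {0..m} \<rightarrow> {0..n}\<close> pulls it back to \<open>[h\<^sub>1, \<dots>, h\<^sub>m]\<close>, where \<open>h\<^sub>j\<close> is the product of the
  \<open>g\<^sub>i\<close> with \<open>\<theta> (j - 1) < i \<le> \<theta> j\<close> (lists are 0-indexed below). It pushes the barycentric
  coordinates of a point of the standard \<open>m\<close>-simplex forward to the standard \<open>n\<close>-simplex.
\<close>

definition nerve_pull :: "('g, 'c) monoid_scheme \<Rightarrow> nat \<Rightarrow> (nat \<Rightarrow> nat) \<Rightarrow> 'g list \<Rightarrow> 'g list" where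
  "nerve_pull G m \<theta> xs =
     map (\<lambda>j. foldr (mult G) (take (\<theta> (Suc j) - \<theta> j) (drop (\<theta> j) xs)) \<one>\<^bsub>G\<^esub>) [0..<m]"

definition simplex_push :: "nat \<Rightarrow> (nat \<Rightarrow> nat) \<Rightarrow> (nat \<Rightarrow> real) \<Rightarrow> nat \<Rightarrow> real" where
  "simplex_push m \<theta> t = (\<lambda>i. \<Sum>j | j \<le> m \<and> \<theta> j = i. t j)"

inductive realization_step ::
    "('g, 'c) monoid_scheme \<Rightarrow> 'g list \<times> (nat \<Rightarrow> real) \<Rightarrow> 'g list \<times> (nat \<Rightarrow> real) \<Rightarrow> bool"
  for G where
  "\<lbrakk>xs \<in> lists (carrier G); \<theta> \<in> {..m} \<rightarrow> {..length xs}; mono_on {..m} \<theta>; t \<in> standard_simplex m\<rbrakk>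
   \<Longrightarrow> realization_step G (nerve_pull G m \<theta> xs, t) (xs, simplex_push m \<theta> t)"

definition bar_class ::
    "('g, 'c) monoid_scheme \<Rightarrow> 'g list \<times> (nat \<Rightarrow> real) \<Rightarrow> ('g list \<times> (nat \<Rightarrow> real)) set" where
  "bar_class G x = {y. equivclp (realization_step G) x y}"

definition simplices_topology ::
    "('g, 'c) monoid_scheme \<Rightarrow> ('g list \<times> (nat \<Rightarrow> real)) topology" where
  "simplices_topology G =
     sum_topology (\<lambda>xs. subtopology (powertop_real UNIV) (standard_simplex (length xs)))
       (lists (carrier G))"

definition quotient_topology :: "'a topology \<Rightarrow> ('a \<Rightarrow> 'b) \<Rightarrow> 'b topology" where
  "quotient_topology X f =
     topology (\<lambda>V. V \<subseteq> f ` topspace X \<and> openin X {x \<in> topspace X. f x \<in> V})"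

definition classifying_space ::
    "('g, 'c) monoid_scheme \<Rightarrow> ('g list \<times> (nat \<Rightarrow> real)) set topology" where
  "classifying_space G = quotient_topology (simplices_topology G) (bar_class G)"

text \<open>
  For a homomorphism \<open>f\<close> into \<open>H\<close>, the induced map sends the class of \<open>([g\<^sub>1, \<dots>, g\<^sub>n], t)\<close> to the
  class of \<open>([f g\<^sub>1, \<dots>, f g\<^sub>n], t)\<close>; the union below is taken over representatives, all of which give the same class.
\<close>

definition classifying_map ::
    "('h, 'c) monoid_scheme \<Rightarrow> ('g \<Rightarrow> 'h) \<Rightarrow>
     ('g list \<times> (nat \<Rightarrow> real)) set \<Rightarrow> ('h list \<times> (nat \<Rightarrow> real)) set" where
  "classifying_map H f c = (\<Union>(xs, t)\<in>c. bar_class H (map f xs, t))"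


section \<open>Sectional category and parametrized LS-category\<close>

text \<open>The infimum of the empty set is \<open>\<infinity>\<close> in \<^typ>\<open>enat\<close>.\<close>

definition secat :: "'e topology \<Rightarrow> 'y topology \<Rightarrow> ('e \<Rightarrow> 'y) \<Rightarrow> enat" where
  "secat E Y q =
     Inf (enat ` {n. \<exists>U :: nat \<Rightarrow> 'y set.
       (\<forall>i\<le>n. openin Y (U i)) \<and> (\<Union>i\<le>n. U i) = topspace Y \<and>
       (\<forall>i\<le>n. \<exists>\<sigma>. continuous_map (subtopology Y (U i)) E \<sigma> \<and> (\<forall>y\<in>U i. q (\<sigma> y) = y))})"

text \<open>
  Points of a mapping space are extensional functions, so that two maps are equal as soon as they
  agree on the domain space.
\<close>

definition compact_open :: "'a topology \<Rightarrow> 'b topology \<Rightarrow> ('a \<Rightarrow> 'b) topology" where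
  "compact_open X Y =
     topology_generated_by
       {{f \<in> extensional (topspace X). continuous_map X Y f \<and> f ` C \<subseteq> W} | C W.
         compactin X C \<and> openin Y W}"

definition param_path_space ::
    "'x topology \<Rightarrow> ('x \<Rightarrow> 'b) \<Rightarrow> ('b \<Rightarrow> 'x) \<Rightarrow> (real \<Rightarrow> 'x) topology" where
  "param_path_space X q s =
     subtopology (compact_open (top_of_set {0..1}) X)
       {\<alpha>. (\<forall>t\<in>{0..1}. q (\<alpha> t) = q (\<alpha> 0)) \<and> \<alpha> 0 = s (q (\<alpha> 0))}"

definition param_cat :: "'x topology \<Rightarrow> ('x \<Rightarrow> 'b) \<Rightarrow> ('b \<Rightarrow> 'x) \<Rightarrow> enat" where
  "param_cat X q s = secat (param_path_space X q s) X (\<lambda>\<alpha>. \<alpha> 1)"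


section \<open>The complexity of a derivation\<close>

definition tc ::
    "('k, 'b) monoid_scheme \<Rightarrow> ('g, 'c) monoid_scheme \<Rightarrow> ('g \<Rightarrow> 'k \<Rightarrow> 'k) \<Rightarrow> ('g \<Rightarrow> 'k) \<Rightarrow> enat" where
  "tc K G act d =
     param_cat (classifying_space (semidirect K G act))
       (classifying_map G snd)
       (classifying_map (semidirect K G act) (splitting d))"

end

theory Submission
  imports Defs
begin

text \<open>
  The pointwise difference \<open>e\<close> of two derivations with values in an abelian group is again a
  derivation, and a derivation \<open>e\<close> gives an endomorphism \<open>(k, g) \<mapsto> (k + e g, g)\<close> of
  \<open>K \<rtimes> G\<close>, with inverse given by \<open>- e\<close>. For \<open>e = d' - d\<close> this automorphism commutes with the
  projection to \<open>G\<close> and carries the splitting of \<open>d\<close> to that of \<open>d'\<close>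
  (\<open>derivation_diff\<close>, \<open>shear_hom\<close>). Applying the classifying space functor turns it into
  a self-homeomorphism of \<open>B (K \<rtimes> G)\<close> over \<open>B G\<close> that carries the section induced by
  \<open>d\<close> to the one induced by \<open>d'\<close>. The parametrized LS-category is an invariant of a space over a base with a section,
  since local sections of the path evaluation are transported by composing paths with the
  homeomorphism (lemma \<open>param_cat_le_of_retraction\<close>).
\<close>

section \<open>Parametrized category under maps over a base\<close>

lemma topspace_compact_open:
  "topspace (compact_open X Y) = {f \<in> extensional (topspace X). continuous_map X Y f}"
proof -
  \<comment> \<open>The subbasic set for \<open>C = {}\<close> is the whole mapping space.\<close>
  have "{f \<in> extensional (topspace X). continuous_map X Y f} \<in>
    {{f \<in> extensional (topspace X). continuous_map X Y f \<and> f ` C \<subseteq> W} | C W.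
         compactin X C \<and> openin Y W}"
    by (rule CollectI, intro exI[of _ "{}"] exI[of _ "{}"]) auto
  then show ?thesis
    unfolding compact_open_def topology_generated_by_topspace by blast
qed

text \<open>
  Postcomposition with \<open>h\<close> pulls the subbasic set of maps sending \<open>C\<close> into \<open>W\<close> back to the
  one for \<open>C\<close> and the preimage of \<open>W\<close> under \<open>h\<close>. The restriction makes the composite extensional.
\<close>

lemma continuous_map_compact_open_postcompose:
  assumes h: "continuous_map Y Z h"
  shows "continuous_map (compact_open X Y) (compact_open X Z)
           (\<lambda>f. restrict (h \<circ> f) (topspace X))"
proof -
  have maps: "restrict (h \<circ> f) (topspace X) \<in> {f \<in> extensional (topspace X). continuous_map X Z f}"
    if "f \<in> topspace (compact_open X Y)" for f
  proof -
    have "continuous_map X Z (h \<circ> f)"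
      using that h by (auto simp: topspace_compact_open intro: continuous_map_compose)
    then show ?thesis
      by (auto intro: continuous_map_eq)
  qed
  show ?thesis
    unfolding compact_open_def[of X Z]
  proof (rule continuous_on_generated_topo)
    fix U
    assume "U \<in> {{f \<in> extensional (topspace X). continuous_map X Z f \<and> f ` C \<subseteq> W} | C W.
         compactin X C \<and> openin Z W}"
    then obtain C W where C: "compactin X C" and W: "openin Z W"
      and U: "U = {f \<in> extensional (topspace X). continuous_map X Z f \<and> f ` C \<subseteq> W}"
      by blast
    let ?W = "{y \<in> topspace Y. h y \<in> W}"
    have CX: "C \<subseteq> topspace X"
      using C compactin_subset_topspace by blast
    have "(\<lambda>f. restrict (h \<circ> f) (topspace X)) -` U \<inter> topspace (compact_open X Y)
      = {f \<in> extensional (topspace X). continuous_map X Y f \<and> f ` C \<subseteq> ?W}" (is "?L = ?R")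
    proof (intro equalityI subsetI)
      fix f assume f: "f \<in> ?L"
      then have "f \<in> extensional (topspace X)" "continuous_map X Y f"
        by (auto simp: topspace_compact_open)
      moreover have "f x \<in> ?W" if "x \<in> C" for x
      proof -
        have "x \<in> topspace X" using that CX by blast
        moreover have "restrict (h \<circ> f) (topspace X) x \<in> W"
          using f that unfolding U by blast
        ultimately show ?thesis
          using \<open>continuous_map X Y f\<close> continuous_map_image_subset_topspace by fastforce
      qed
      ultimately show "f \<in> ?R" by blast
    next
      fix f assume f: "f \<in> ?R"
      then have "f \<in> topspace (compact_open X Y)"
        by (simp add: topspace_compact_open)
      with maps f CX show "f \<in> ?L"
        unfolding U by (auto simp: subset_iff image_subset_iff)
    qed
    moreover have "openin Y ?W"
      using h W by (rule openin_continuous_map_preimage)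
    ultimately show "openin (compact_open X Y)
        ((\<lambda>f. restrict (h \<circ> f) (topspace X)) -` U \<inter> topspace (compact_open X Y))"
      using C unfolding compact_open_def by (auto intro!: topology_generated_by_Basis)
  next
    show "(\<lambda>f. restrict (h \<circ> f) (topspace X)) ` topspace (compact_open X Y)
        \<subseteq> \<Union> {{f \<in> extensional (topspace X). continuous_map X Z f \<and> f ` C \<subseteq> W} | C W.
             compactin X C \<and> openin Z W}"
      using maps unfolding topspace_compact_open[of X Z, symmetric]
      unfolding compact_open_def[of X Z] topology_generated_by_topspace by blast
  qed
qed

lemma secat_le:
  assumes "\<And>(n::nat) U. \<lbrakk>\<And>i. i \<le> n \<Longrightarrow> openin Y (U i); (\<Union>i\<le>n. U i) = topspace Y;
       \<And>i. i \<le> n \<Longrightarrow> \<exists>\<sigma>. continuous_map (subtopology Y (U i)) E \<sigma> \<and> (\<forall>y\<in>U i. q (\<sigma> y) = y)\<rbrakk>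
     \<Longrightarrow> \<exists>V. (\<forall>i\<le>n. openin Y' (V i)) \<and> (\<Union>i\<le>n. V i) = topspace Y' \<and>
       (\<forall>i\<le>n. \<exists>\<sigma>. continuous_map (subtopology Y' (V i)) E' \<sigma> \<and> (\<forall>y\<in>V i. q' (\<sigma> y) = y))"
  shows "secat E' Y' q' \<le> secat E Y q"
  unfolding secat_def
proof (rule Inf_superset_mono, rule image_mono, rule subsetI)
  fix n :: nat
  assume "n \<in> {n. \<exists>U. (\<forall>i\<le>n. openin Y (U i)) \<and> (\<Union>i\<le>n. U i) = topspace Y \<and>
       (\<forall>i\<le>n. \<exists>\<sigma>. continuous_map (subtopology Y (U i)) E \<sigma> \<and> (\<forall>y\<in>U i. q (\<sigma> y) = y))}"
  then obtain U where U: "\<forall>i\<le>n. openin Y (U i)" "(\<Union>i\<le>n. U i) = topspace Y"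
       "\<forall>i\<le>n. \<exists>\<sigma>. continuous_map (subtopology Y (U i)) E \<sigma> \<and> (\<forall>y\<in>U i. q (\<sigma> y) = y)"
    unfolding mem_Collect_eq by (elim exE conjE) (rule that)
  show "n \<in> {n. \<exists>U. (\<forall>i\<le>n. openin Y' (U i)) \<and> (\<Union>i\<le>n. U i) = topspace Y' \<and>
       (\<forall>i\<le>n. \<exists>\<sigma>. continuous_map (subtopology Y' (U i)) E' \<sigma> \<and> (\<forall>y\<in>U i. q' (\<sigma> y) = y))}"
    unfolding mem_Collect_eq
    by (rule assms[of n U, OF U(1)[rule_format] U(2) U(3)[rule_format]])
qed

text \<open>
  A local section \<open>\<sigma>\<close> on \<open>U\<close> is transported to \<open>y \<mapsto> h \<circ> \<sigma> (r y)\<close> on the preimage of \<open>U\<close> under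
  \<open>r\<close>: its paths stay in the fibres because \<open>h\<close> lies over the base, start on the section \<open>s'\<close>
  because \<open>h\<close> preserves the sections, and end at \<open>h (r y) = y\<close>.
\<close>

lemma param_cat_le_of_retraction:
  assumes h: "continuous_map X Y h" and r: "continuous_map Y X r"
    and hr: "\<And>y. y \<in> topspace Y \<Longrightarrow> h (r y) = y"
    and q: "\<And>x. x \<in> topspace X \<Longrightarrow> q' (h x) = q x"
    and s: "\<And>x. x \<in> topspace X \<Longrightarrow> h (s (q x)) = s' (q x)"
  shows "param_cat Y q' s' \<le> param_cat X q s"
  unfolding param_cat_def
proof (rule secat_le)
  fix n U
  assume U: "\<And>i. i \<le> n \<Longrightarrow> openin X (U i)" and cover: "(\<Union>i\<le>n. U i) = topspace X"
    and sec: "\<And>i. i \<le> n \<Longrightarrow> \<exists>\<sigma>. continuous_map (subtopology X (U i)) (param_path_space X q s) \<sigma> \<and>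
                (\<forall>x\<in>U i. \<sigma> x 1 = x)"
  define V where "V i = {y \<in> topspace Y. r y \<in> U i}" for i
  let ?I = "top_of_set {0..1::real}"
  let ?H = "\<lambda>\<alpha>. restrict (h \<circ> \<alpha>) {0..1}"
  have "continuous_map (param_path_space X q s) (compact_open ?I Y) ?H"
    unfolding param_path_space_def
    using continuous_map_compact_open_postcompose[OF h, of ?I]
    by (simp add: continuous_map_from_subtopology)
  then have H: "continuous_map (param_path_space X q s) (param_path_space Y q' s') ?H"
    unfolding param_path_space_def[of Y]
  proof (rule continuous_map_into_subtopology, intro Pi_I)
    fix \<alpha> assume "\<alpha> \<in> topspace (param_path_space X q s)"
    then have "continuous_map ?I X \<alpha> \<and> (\<forall>t\<in>{0..1}. q (\<alpha> t) = q (\<alpha> 0)) \<and> \<alpha> 0 = s (q (\<alpha> 0))"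
      unfolding param_path_space_def topspace_subtopology topspace_compact_open by blast
    then have "continuous_map ?I X \<alpha>" and fib: "\<And>t. t \<in> {0..1} \<Longrightarrow> q (\<alpha> t) = q (\<alpha> 0)"
      and start: "\<alpha> 0 = s (q (\<alpha> 0))"
      by blast+
    from this(1) have im: "\<alpha> t \<in> topspace X" if "t \<in> {0..1}" for t
      using that continuous_map_image_subset_topspace by fastforce
    have "q' (h (\<alpha> t)) = q' (h (\<alpha> 0))" if "t \<in> {0..1}" for t
      using q[OF im[OF that]] q[OF im, of 0] fib[OF that] by simp
    moreover have "h (\<alpha> 0) = s' (q' (h (\<alpha> 0)))"
      using q[OF im, of 0] s[OF im, of 0] start by (metis atLeastAtMost_iff order_refl zero_le_one)
    moreover have "?H \<alpha> \<in> {\<alpha>. (\<forall>t\<in>{0..1}. q' (\<alpha> t) = q' (\<alpha> 0)) \<and> \<alpha> 0 = s' (q' (\<alpha> 0))} \<longleftrightarrow>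
        (\<forall>t\<in>{0..1}. q' (h (\<alpha> t)) = q' (h (\<alpha> 0))) \<and> h (\<alpha> 0) = s' (q' (h (\<alpha> 0)))"
      by simp
    ultimately show "?H \<alpha> \<in> {\<alpha>. (\<forall>t\<in>{0..1}. q' (\<alpha> t) = q' (\<alpha> 0)) \<and> \<alpha> 0 = s' (q' (\<alpha> 0))}"
      by blast
  qed
  have "openin Y (V i)" if "i \<le> n" for i
    unfolding V_def using r U[OF that] by (rule openin_continuous_map_preimage)
  moreover have "(\<Union>i\<le>n. V i) = topspace Y"
    using cover continuous_map_image_subset_topspace[OF r] by (force simp: V_def)
  moreover have "\<exists>\<sigma>. continuous_map (subtopology Y (V i)) (param_path_space Y q' s') \<sigma> \<and>
      (\<forall>y\<in>V i. \<sigma> y 1 = y)" if i: "i \<le> n" for i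
  proof -
    obtain \<sigma> where \<sigma>: "continuous_map (subtopology X (U i)) (param_path_space X q s) \<sigma>"
      and end1: "\<And>x. x \<in> U i \<Longrightarrow> \<sigma> x 1 = x"
      using sec[OF i] by blast
    have "continuous_map (subtopology Y (V i)) (subtopology X (U i)) r"
      using r by (auto simp: continuous_map_in_subtopology continuous_map_from_subtopology V_def)
    then have "continuous_map (subtopology Y (V i)) (param_path_space Y q' s') (?H \<circ> (\<sigma> \<circ> r))"
      using \<sigma> H by (blast intro: continuous_map_compose)
    moreover have "(?H \<circ> (\<sigma> \<circ> r)) y 1 = y" if "y \<in> V i" for y
      using that end1 hr by (simp add: V_def)
    ultimately show ?thesis by blast
  qed
  ultimately show "\<exists>V. (\<forall>i\<le>n. openin Y (V i)) \<and> (\<Union>i\<le>n. V i) = topspace Y \<and>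
       (\<forall>i\<le>n. \<exists>\<sigma>. continuous_map (subtopology Y (V i)) (param_path_space Y q' s') \<sigma> \<and>
          (\<forall>y\<in>V i. \<sigma> y 1 = y))"
    by blast
qed

section \<open>Functoriality of the classifying space\<close>

lemma quotient_map_quotient_topology:
  "quotient_map X (quotient_topology X f) f"
proof -
  let ?open = "\<lambda>V. V \<subseteq> f ` topspace X \<and> openin X {x \<in> topspace X. f x \<in> V}"
  have "istopology ?open"
    unfolding istopology_def
  proof (intro conjI allI impI)
    fix S T assume "?open S" "?open T"
    moreover have "{x \<in> topspace X. f x \<in> S \<inter> T}
        = {x \<in> topspace X. f x \<in> S} \<inter> {x \<in> topspace X. f x \<in> T}"
      by blast
    ultimately show "openin X {x \<in> topspace X. f x \<in> S \<inter> T}"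
      by auto
    show "S \<inter> T \<subseteq> f ` topspace X" using \<open>?open S\<close> by blast
  next
    fix \<K> assume "\<forall>K\<in>\<K>. ?open K"
    moreover have "{x \<in> topspace X. f x \<in> \<Union>\<K>} = (\<Union>K\<in>\<K>. {x \<in> topspace X. f x \<in> K})"
      by blast
    ultimately show "openin X {x \<in> topspace X. f x \<in> \<Union>\<K>}"
      by auto
    show "\<Union>\<K> \<subseteq> f ` topspace X" using \<open>\<forall>K\<in>\<K>. ?open K\<close> by blast
  qed
  then have op: "openin (quotient_topology X f) V \<longleftrightarrow> ?open V" for V
    unfolding quotient_topology_def by simp
  have "{x \<in> topspace X. f x \<in> f ` topspace X} = topspace X"
    by blast
  then have "openin (quotient_topology X f) (f ` topspace X)"
    by (simp add: op)
  then have "topspace (quotient_topology X f) = f ` topspace X"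
    using op by (metis openin_subset openin_topspace subset_antisym)
  then show ?thesis
    by (auto simp: quotient_map_def op)
qed

lemma topspace_simplices_topology:
  "topspace (simplices_topology G) = (SIGMA xs:lists (carrier G). standard_simplex (length xs))"
  by (auto simp: simplices_topology_def)

lemma topspace_classifying_spaceE:
  assumes "c \<in> topspace (classifying_space G)"
  obtains xs t where "xs \<in> lists (carrier G)" "t \<in> standard_simplex (length xs)"
    "c = bar_class G (xs, t)"
proof -
  have "topspace (classifying_space G) = bar_class G ` topspace (simplices_topology G)"
    unfolding classifying_space_def
    using quotient_map_quotient_topology quotient_imp_surjective_map by metis
  then obtain x where "x \<in> topspace (simplices_topology G)" "c = bar_class G x"
    using assms by blast
  then show ?thesis
    using that unfolding topspace_simplices_topology by blast
qed

text \<open>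
  The face and degeneracy operators of the nerve multiply consecutive entries, where an empty
  product is the unit; a map therefore commutes with them as soon as it preserves products and
  the unit.
\<close>

lemma nerve_pull_map:
  assumes "monoid G" and f: "f \<in> hom G H" "f \<one>\<^bsub>G\<^esub> = \<one>\<^bsub>H\<^esub>" and xs: "xs \<in> lists (carrier G)"
  shows "map f (nerve_pull G m \<theta> xs) = nerve_pull H m \<theta> (map f xs)"
proof -
  interpret monoid G by fact
  have "foldr (mult G) ys \<one>\<^bsub>G\<^esub> \<in> carrier G \<and>
      f (foldr (mult G) ys \<one>\<^bsub>G\<^esub>) = foldr (mult H) (map f ys) \<one>\<^bsub>H\<^esub>"
    if "ys \<in> lists (carrier G)" for ys
    using that by (induction ys) (auto simp: f hom_mult[OF f(1)])
  moreover have "take i (drop j xs) \<in> lists (carrier G)" for i j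
    using xs by (auto dest!: in_set_takeD in_set_dropD)
  ultimately show ?thesis
    by (simp add: nerve_pull_def take_map drop_map)
qed

lemma realization_step_map:
  assumes G: "monoid G" and f: "f \<in> hom G H" "f \<one>\<^bsub>G\<^esub> = \<one>\<^bsub>H\<^esub>"
    and step: "realization_step G x y"
  shows "realization_step H (map_prod (map f) id x) (map_prod (map f) id y)"
  using step
proof cases
  case (1 xs \<theta> m t)
  have "map f xs \<in> lists (carrier H)"
    using 1 by (auto simp: hom_in_carrier[OF f(1)])
  then show ?thesis
    using 1 realization_step.intros[of "map f xs" H \<theta> m t] nerve_pull_map[OF G f]
    by simp
qed

lemma bar_class_eq_iff: "bar_class G x = bar_class G y \<longleftrightarrow> equivclp (realization_step G) x y"
proof
  assume eq: "bar_class G x = bar_class G y"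
  have "y \<in> bar_class G y"
    by (simp add: bar_class_def)
  then have "y \<in> bar_class G x"
    by (simp only: eq)
  then show "equivclp (realization_step G) x y"
    by (simp add: bar_class_def)
next
  assume "equivclp (realization_step G) x y"
  then show "bar_class G x = bar_class G y"
    unfolding bar_class_def by (intro Collect_cong) (metis equivclp_sym equivclp_trans)
qed

lemma bar_class_map:
  assumes G: "monoid G" and f: "f \<in> hom G H" "f \<one>\<^bsub>G\<^esub> = \<one>\<^bsub>H\<^esub>"
    and eq: "equivclp (realization_step G) x y"
  shows "bar_class H (map_prod (map f) id x) = bar_class H (map_prod (map f) id y)"
  using eq
proof (induction rule: equivclp_induct)
  case base
  show ?case by simp
next
  case (step y z)
  then have "equivclp (realization_step H) (map_prod (map f) id y) (map_prod (map f) id z)"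
    using realization_step_map[OF G f] by (meson r_into_equivclp converse_r_into_equivclp)
  with step.IH show ?case
    by (metis bar_class_eq_iff)
qed

lemma classifying_map_bar_class:
  assumes G: "monoid G" and f: "f \<in> hom G H" "f \<one>\<^bsub>G\<^esub> = \<one>\<^bsub>H\<^esub>"
  shows "classifying_map H f (bar_class G (xs, t)) = bar_class H (map f xs, t)"
proof -
  have "bar_class H (map f ys, u) = bar_class H (map f xs, t)"
    if "(ys, u) \<in> bar_class G (xs, t)" for ys u
    using bar_class_map[OF G f, of "(xs, t)" "(ys, u)"] that by (simp add: bar_class_def)
  moreover have "(xs, t) \<in> bar_class G (xs, t)"
    by (simp add: bar_class_def)
  ultimately show ?thesis
    unfolding classifying_map_def by blast
qed

text \<open>
  By the universal property of the quotient it suffices to look at the disjoint union of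
  simplices, where the map sends the simplex labelled \<open>xs\<close> identically onto the one labelled
  \<open>map f xs\<close>, of the same dimension.
\<close>

lemma continuous_map_classifying_map:
  assumes G: "monoid G" and f: "f \<in> hom G H" "f \<one>\<^bsub>G\<^esub> = \<one>\<^bsub>H\<^esub>"
  shows "continuous_map (classifying_space G) (classifying_space H) (classifying_map H f)"
proof -
  let ?F = "map_prod (map f) id :: 'a list \<times> (nat \<Rightarrow> real) \<Rightarrow> 'c list \<times> (nat \<Rightarrow> real)"
  have maps: "map f xs \<in> lists (carrier H)" if "xs \<in> lists (carrier G)" for xs
    using that by (auto simp: hom_in_carrier[OF f(1)])
  have "continuous_map (simplices_topology G) (simplices_topology H) ?F"
    unfolding continuous_map_def
  proof (intro conjI allI impI)
    show "?F \<in> topspace (simplices_topology G) \<rightarrow> topspace (simplices_topology H)"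
      using maps unfolding topspace_simplices_topology by fastforce
  next
    fix U assume "openin (simplices_topology H) U"
    then have U: "openin (subtopology (powertop_real UNIV) (standard_simplex (length xs)))
        {t. (xs, t) \<in> U}" if "xs \<in> lists (carrier H)" for xs
      using that by (simp add: simplices_topology_def openin_sum_topology)
    have "openin (subtopology (powertop_real UNIV) (standard_simplex (length xs)))
        {t. (xs, t) \<in> {x \<in> topspace (simplices_topology G). ?F x \<in> U}}"
      if xs: "xs \<in> lists (carrier G)" for xs
    proof -
      have "openin (subtopology (powertop_real UNIV) (standard_simplex (length xs)))
          {t. (map f xs, t) \<in> U}"
        using U[OF maps[OF xs]] by simp
      moreover from openin_subset[OF this]
      have "{t. (xs, t) \<in> {x \<in> topspace (simplices_topology G). ?F x \<in> U}}
          = {t. (map f xs, t) \<in> U}"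
        using xs by (auto simp: topspace_simplices_topology)
      ultimately show ?thesis by simp
    qed
    then show "openin (simplices_topology G) {x \<in> topspace (simplices_topology G). ?F x \<in> U}"
      by (subst simplices_topology_def)
        (auto simp: openin_sum_topology topspace_simplices_topology)
  qed
  then have "continuous_map (simplices_topology G) (classifying_space H) (bar_class H \<circ> ?F)"
    unfolding classifying_space_def
    using quotient_map_quotient_topology quotient_imp_continuous_map continuous_map_compose
    by blast
  moreover have "bar_class H \<circ> ?F = classifying_map H f \<circ> bar_class G"
    by (auto simp: fun_eq_iff classifying_map_bar_class[OF G f])
  ultimately show ?thesis
    unfolding classifying_space_def
    using continuous_compose_quotient_map[OF quotient_map_quotient_topology] by metis
qed

lemma classifying_map_compose:
  assumes "monoid G" and f: "f \<in> hom G H" "f \<one>\<^bsub>G\<^esub> = \<one>\<^bsub>H\<^esub>"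
    and "monoid H" and g: "g \<in> hom H L" "g \<one>\<^bsub>H\<^esub> = \<one>\<^bsub>L\<^esub>"
    and c: "c \<in> topspace (classifying_space G)"
    and eq: "\<And>x. x \<in> carrier G \<Longrightarrow> g (f x) = k x"
  shows "classifying_map L g (classifying_map H f c) = classifying_map L k c"
proof -
  interpret monoid G by fact
  have k: "k \<in> hom G L" "k \<one>\<^bsub>G\<^esub> = \<one>\<^bsub>L\<^esub>"
  proof -
    show "k \<in> hom G L"
      using f g by (intro homI) (simp_all add: eq[symmetric] hom_mult hom_in_carrier)
    show "k \<one>\<^bsub>G\<^esub> = \<one>\<^bsub>L\<^esub>"
      using f g eq[of "\<one>\<^bsub>G\<^esub>"] by simp
  qed
  obtain xs t where xs: "xs \<in> lists (carrier G)" and c': "c = bar_class G (xs, t)"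
    using c by (rule topspace_classifying_spaceE)
  have "map (g \<circ> f) xs = map k xs"
    using xs eq by auto
  then show ?thesis
    using assms k by (simp add: c' classifying_map_bar_class del: map_eq_conv)
qed

lemma classifying_map_ident:
  assumes "monoid G" and c: "c \<in> topspace (classifying_space G)"
  shows "classifying_map G (\<lambda>x. x) c = c"
proof -
  obtain xs t where "c = bar_class G (xs, t)"
    using c by (rule topspace_classifying_spaceE)
  then show ?thesis
    using classifying_map_bar_class[OF assms(1), of "\<lambda>x. x" G xs t] by (simp add: hom_def)
qed

section \<open>Shearing a semi-direct product by a difference of derivations\<close>

locale automorphism_action = G: group G + K: group K
  for G :: "('g, 'c) monoid_scheme" and K :: "('k, 'b) monoid_scheme" +
  fixes act :: "'g \<Rightarrow> 'k \<Rightarrow> 'k"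
  assumes act_hom: "act \<in> hom G (AutoGroup K)"
begin

lemma act_auto: "g \<in> carrier G \<Longrightarrow> act g \<in> auto K"
  using act_hom by (auto simp: hom_def AutoGroup_def)

lemma act_closed [simp]: "\<lbrakk>g \<in> carrier G; k \<in> carrier K\<rbrakk> \<Longrightarrow> act g k \<in> carrier K"
  using act_auto by (auto simp: auto_def hom_def)

lemma act_mult:
  "\<lbrakk>g \<in> carrier G; k \<in> carrier K; l \<in> carrier K\<rbrakk>
    \<Longrightarrow> act g (k \<otimes>\<^bsub>K\<^esub> l) = act g k \<otimes>\<^bsub>K\<^esub> act g l"
  using act_auto by (auto simp: auto_def hom_def)

lemma act_hom_self: "g \<in> carrier G \<Longrightarrow> act g \<in> hom K K"
  using act_auto by (simp add: auto_def)

lemma act_unit [simp]: "g \<in> carrier G \<Longrightarrow> act g \<one>\<^bsub>K\<^esub> = \<one>\<^bsub>K\<^esub>"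
  using act_hom_self K.is_group by (simp add: hom_one)

lemma act_inv:
  "\<lbrakk>g \<in> carrier G; k \<in> carrier K\<rbrakk> \<Longrightarrow> act g (inv\<^bsub>K\<^esub> k) = inv\<^bsub>K\<^esub> act g k"
  by (intro group_hom.hom_inv group_hom.intro group_hom_axioms.intro)
    (simp_all add: act_hom_self K.is_group)

lemma act_compose:
  "\<lbrakk>g \<in> carrier G; h \<in> carrier G; k \<in> carrier K\<rbrakk> \<Longrightarrow> act (g \<otimes>\<^bsub>G\<^esub> h) k = act g (act h k)"
  using act_hom act_auto
  by (simp add: hom_def AutoGroup_def BijGroup_def auto_def compose_def)

lemma act_one [simp]:
  assumes k: "k \<in> carrier K"
  shows "act \<one>\<^bsub>G\<^esub> k = k"
proof -
  \<comment> \<open>The unit acts idempotently and injectively.\<close>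
  have "act \<one>\<^bsub>G\<^esub> (act \<one>\<^bsub>G\<^esub> k) = act \<one>\<^bsub>G\<^esub> k"
    using k act_compose[of "\<one>\<^bsub>G\<^esub>" "\<one>\<^bsub>G\<^esub>" k] by simp
  moreover have "inj_on (act \<one>\<^bsub>G\<^esub>) (carrier K)"
    using act_auto[OF G.one_closed] by (simp add: auto_def Bij_def bij_betw_def)
  ultimately show ?thesis
    using k by (auto dest: inj_onD)
qed

abbreviation S where "S \<equiv> semidirect K G act"

lemma carrier_semidirect [simp]: "carrier S = carrier K \<times> carrier G"
  by (simp add: semidirect_def)

lemma mult_semidirect [simp]:
  "(k, g) \<otimes>\<^bsub>S\<^esub> (l, h) = (k \<otimes>\<^bsub>K\<^esub> act g l, g \<otimes>\<^bsub>G\<^esub> h)"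
  by (simp add: semidirect_def)

lemma one_semidirect [simp]: "\<one>\<^bsub>S\<^esub> = (\<one>\<^bsub>K\<^esub>, \<one>\<^bsub>G\<^esub>)"
  by (simp add: semidirect_def)

lemma monoid_semidirect: "monoid S"
  by (rule monoidI) (auto simp: act_mult act_compose K.m_assoc G.m_assoc)

lemma snd_hom: "snd \<in> hom S G"
  by (auto simp: hom_def)

text \<open>
  The derivation equation at the pair of units forces this; it makes the splitting and the
  shear unital, hence compatible with the degeneracies of the nerve.
\<close>

lemma derivation_one:
  assumes "derivation K G act d"
  shows "d \<one>\<^bsub>G\<^esub> = \<one>\<^bsub>K\<^esub>"
proof -
  have "d \<one>\<^bsub>G\<^esub> \<in> carrier K" "d (\<one>\<^bsub>G\<^esub> \<otimes>\<^bsub>G\<^esub> \<one>\<^bsub>G\<^esub>) = d \<one>\<^bsub>G\<^esub> \<otimes>\<^bsub>K\<^esub> act \<one>\<^bsub>G\<^esub> (d \<one>\<^bsub>G\<^esub>)"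
    using assms G.one_closed unfolding derivation_def by blast+
  then show ?thesis
    using K.r_cancel_one by simp
qed

lemma splitting_hom:
  assumes "derivation K G act d"
  shows "splitting d \<in> hom G S"
  using assms by (auto simp: hom_def splitting_def derivation_def)

lemma derivation_diff:
  assumes "comm_group K" and d: "derivation K G act d" and d': "derivation K G act d'"
  shows "derivation K G act (\<lambda>g. d' g \<otimes>\<^bsub>K\<^esub> inv\<^bsub>K\<^esub> d g)"
proof -
  interpret K: comm_group K by fact
  have closed: "d g \<in> carrier K" "d' g \<in> carrier K" if "g \<in> carrier G" for g
    using that d d' by (auto simp: derivation_def)
  show ?thesis
    unfolding derivation_def
  proof (intro conjI ballI)
    fix g h assume gh: "g \<in> carrier G" "h \<in> carrier G"
    then have "d' (g \<otimes>\<^bsub>G\<^esub> h) \<otimes>\<^bsub>K\<^esub> inv\<^bsub>K\<^esub> d (g \<otimes>\<^bsub>G\<^esub> h)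
      = (d' g \<otimes>\<^bsub>K\<^esub> act g (d' h)) \<otimes>\<^bsub>K\<^esub> (inv\<^bsub>K\<^esub> d g \<otimes>\<^bsub>K\<^esub> inv\<^bsub>K\<^esub> act g (d h))"
      using d d' closed by (simp add: derivation_def K.inv_mult)
    then show "d' (g \<otimes>\<^bsub>G\<^esub> h) \<otimes>\<^bsub>K\<^esub> inv\<^bsub>K\<^esub> d (g \<otimes>\<^bsub>G\<^esub> h)
      = d' g \<otimes>\<^bsub>K\<^esub> inv\<^bsub>K\<^esub> d g \<otimes>\<^bsub>K\<^esub> act g (d' h \<otimes>\<^bsub>K\<^esub> inv\<^bsub>K\<^esub> d h)"
      using gh closed by (simp add: act_mult act_inv K.m_ac)
  qed (use closed in auto)
qed

text \<open>
  Multiplicativity rests on commutativity of \<open>K\<close>: in the product of \<open>(k + e g, g)\<close> and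
  \<open>(l + e h, h)\<close> the term \<open>e g\<close> has to be moved past \<open>g \<cdot> l\<close>.
\<close>

lemma shear_hom:
  assumes "comm_group K" and e: "derivation K G act e"
  shows "(\<lambda>(k, g). (k \<otimes>\<^bsub>K\<^esub> e g, g)) \<in> hom S S"
proof -
  interpret K: comm_group K by fact
  have closed: "e g \<in> carrier K" if "g \<in> carrier G" for g
    using that e by (auto simp: derivation_def)
  show ?thesis
  proof (rule homI)
    fix x y assume "x \<in> carrier S" "y \<in> carrier S"
    moreover obtain k g l h where "x = (k, g)" "y = (l, h)" by (metis surj_pair)
    ultimately show "(\<lambda>(k, g). (k \<otimes>\<^bsub>K\<^esub> e g, g)) (x \<otimes>\<^bsub>S\<^esub> y)
        = (\<lambda>(k, g). (k \<otimes>\<^bsub>K\<^esub> e g, g)) x \<otimes>\<^bsub>S\<^esub> (\<lambda>(k, g). (k \<otimes>\<^bsub>K\<^esub> e g, g)) y"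
      using e closed by (simp add: derivation_def act_mult K.m_ac)
  qed (use closed in auto)
qed

text \<open>
  The hypotheses are symmetric in \<open>d\<close> and \<open>d'\<close>, so one inequality is enough for equality. It
  comes from the shear by \<open>d' - d\<close>, with the shear by \<open>d - d'\<close> as its right inverse.
\<close>

lemma tc_le:
  assumes K: "comm_group K" and d: "derivation K G act d" and d': "derivation K G act d'"
  shows "tc K G act d' \<le> tc K G act d"
proof -
  interpret K: comm_group K by fact
  define shear where "shear e = (\<lambda>(k, g). (k \<otimes>\<^bsub>K\<^esub> e g, g))" for e :: "'g \<Rightarrow> 'k"
  define e where "e g = d' g \<otimes>\<^bsub>K\<^esub> inv\<^bsub>K\<^esub> d g" for g
  define e' where "e' g = d g \<otimes>\<^bsub>K\<^esub> inv\<^bsub>K\<^esub> d' g" for g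
  have closed: "d g \<in> carrier K" "d' g \<in> carrier K" if "g \<in> carrier G" for g
    using that d d' by (auto simp: derivation_def)
  have der: "derivation K G act e" "derivation K G act e'"
    unfolding e_def e'_def using K d d' by (auto intro: derivation_diff)
  have hom: "shear e \<in> hom S S" "shear e' \<in> hom S S"
    unfolding shear_def using K der by (auto intro: shear_hom)
  have one: "shear e \<one>\<^bsub>S\<^esub> = \<one>\<^bsub>S\<^esub>" "shear e' \<one>\<^bsub>S\<^esub> = \<one>\<^bsub>S\<^esub>"
    using der by (simp_all add: shear_def derivation_one)
  have split: "splitting d \<in> hom G S" "splitting d \<one>\<^bsub>G\<^esub> = \<one>\<^bsub>S\<^esub>"
    using d by (simp_all add: splitting_hom splitting_def derivation_one)
  have proj: "snd \<one>\<^bsub>S\<^esub> = \<one>\<^bsub>G\<^esub>"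
    by simp
  have cancel: "k \<otimes>\<^bsub>K\<^esub> e' g \<otimes>\<^bsub>K\<^esub> e g = k" if "k \<in> carrier K" "g \<in> carrier G" for k g
  proof -
    have "e' g \<otimes>\<^bsub>K\<^esub> e g = d g \<otimes>\<^bsub>K\<^esub> ((inv\<^bsub>K\<^esub> d' g \<otimes>\<^bsub>K\<^esub> d' g) \<otimes>\<^bsub>K\<^esub> inv\<^bsub>K\<^esub> d g)"
      using that closed by (simp only: e_def e'_def K.m_assoc K.inv_closed K.m_closed)
    then have "e' g \<otimes>\<^bsub>K\<^esub> e g = \<one>\<^bsub>K\<^esub>"
      using that closed by simp
    then show ?thesis
      using that closed der by (simp add: K.m_assoc derivation_def Pi_iff)
  qed
  have shift: "d g \<otimes>\<^bsub>K\<^esub> e g = d' g" if "g \<in> carrier G" for g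
  proof -
    have "d g \<otimes>\<^bsub>K\<^esub> e g = d' g \<otimes>\<^bsub>K\<^esub> (d g \<otimes>\<^bsub>K\<^esub> inv\<^bsub>K\<^esub> d g)"
      using that closed by (simp only: e_def K.m_lcomm K.inv_closed)
    then show ?thesis
      using that closed by simp
  qed
  note S = monoid_semidirect
  show ?thesis
    unfolding tc_def
  proof (rule param_cat_le_of_retraction)
    show "continuous_map (classifying_space S) (classifying_space S) (classifying_map S (shear e))"
      using S hom(1) one(1) by (rule continuous_map_classifying_map)
    show "continuous_map (classifying_space S) (classifying_space S) (classifying_map S (shear e'))"
      using S hom(2) one(2) by (rule continuous_map_classifying_map)
  next
    fix y assume y: "y \<in> topspace (classifying_space S)"
    have "classifying_map S (shear e) (classifying_map S (shear e') y) = classifying_map S (\<lambda>x. x) y"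
      by (rule classifying_map_compose[OF S hom(2) one(2) S hom(1) one(1) y])
        (auto simp: shear_def cancel)
    then show "classifying_map S (shear e) (classifying_map S (shear e') y) = y"
      using classifying_map_ident[OF S y] by simp
  next
    fix x assume x: "x \<in> topspace (classifying_space S)"
    show "classifying_map G snd (classifying_map S (shear e) x) = classifying_map G snd x"
      by (rule classifying_map_compose[OF S hom(1) one(1) S snd_hom proj x])
        (auto simp: shear_def)
    have "classifying_map G snd x \<in> topspace (classifying_space G)"
      using continuous_map_classifying_map[OF S snd_hom proj] x
        continuous_map_image_subset_topspace by blast
    then show "classifying_map S (shear e) (classifying_map S (splitting d) (classifying_map G snd x))
        = classifying_map S (splitting d') (classifying_map G snd x)"
      by (rule classifying_map_compose[OF G.is_monoid split S hom(1) one(1)])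
        (auto simp: shear_def splitting_def shift)
  qed
qed

end

theorem corollary3p19:
  fixes G :: "('g, 'c) monoid_scheme" and K :: "('k, 'b) monoid_scheme"
    and act :: "'g \<Rightarrow> 'k \<Rightarrow> 'k" and d d' :: "'g \<Rightarrow> 'k"
  assumes "group G" and "comm_group K"
    and "act \<in> hom G (AutoGroup K)"
    and "derivation K G act d" and "derivation K G act d'"
  shows "tc K G act d = tc K G act d'"
proof -
  interpret G: group G by fact
  interpret K: comm_group K by fact
  interpret automorphism_action G K act
    by unfold_locales fact
  show ?thesis
    using tc_le assms by (meson order_antisym)
qed

end
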